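(* Let $\tau>0$, $\epsilon>0$, $\sigma_p,\sigma_n\ge 0$, let $G=(g_{\rho\eta})_{\rho,\eta\in\{p,n\}}$ be a symmetric positive semidefinite real $2\times 2$ matrix, and let the fixed charge $\psi^0=(\psi^0_{i,j})$ and the boundary data $\phi_a,\phi_b,\phi_c,\phi_d$ be given and independent of the time step. Let $(p^0,n^0,\phi^0)$ be real grid functions with $p^0_{i,j}\ge 0$ and $n^0_{i,j}\ge 0$ for all $i,j$ which satisfy the discrete Poisson constraint (P) of the context. Suppose that for every integer $k\ge 0$, $u^{k+1}=(p^{k+1},\boldsymbol m_p^{k+1};\,n^{k+1},\boldsymbol m_n^{k+1};\,\phi^{k+1})$ is a minimizer of the fully discrete Poisson-constrained JKO problem (defined in the context) with data $(p^k,n^k)$. Then for every $k\ge 0$: (i) (energy dissipation) $\mathcal E^h(p^{k+1},n^{k+1},\phi^{k+1})\le \mathcal E^h(p^k,n^k,\phi^k)$; (ii) (mass conservation) $$\sum_{i=1}^{N_x}\sum_{j=1}^{N_y}p^{k+1}_{i,j}\,\Delta x\Delta y=\sum_{i=1}^{N_x}\sum_{j=1}^{N_y}p^{k}_{i,j}\,\Delta x\Delta y,\qquad \sum_{i=1}^{N_x}\sum_{j=1}^{N_y}n^{k+1}_{i,j}\,\Delta x\Delta y=\sum_{i=1}^{N_x}\sum_{j=1}^{N_y}n^{k}_{i,j}\,\Delta x\Delta y;$$ (iii) (positivity preservation) $p^{k+1}_{i,j}\ge 0$ and $n^{k+1}_{i,j}\ge 0$ for all $1\le i\le N_x$, $1\le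 j\le N_y$.
   Context: **Grid.** $\Omega=[a,b]\times[c,d]$ is divided into $N_x\times N_y$ uniform cells, $\Delta x=(b-a)/N_x$, $\Delta y=(d-c)/N_y$. Grid functions are real arrays indexed by cells $(i,j)$, $1\le i\le N_x$, $1\le j\le N_y$. For a grid function $\rho$ (extended by ghost values where needed), $$\mathcal D_x\rho_{i+\frac12,j}=\frac{\rho_{i+1,j}-\rho_{i,j}}{\Delta x},\quad \mathcal D_y\rho_{i,j+\frac12}=\frac{\rho_{i,j+1}-\rho_{i,j}}{\Delta y},\quad \mathcal A_y\rho_{i,j+\frac12}=\frac{\rho_{i,j+1}+\rho_{i,j}}{2}.$$ **Boundary conditions for the potential $\phi$.** Dirichlet conditions $\phi=\phi_a$ at $x=a$ and $\phi=\phi_b$ at $x=b$; Neumann conditions $\epsilon\,\partial_{\mathbf n}\phi=\phi_c$ at $y=c$ and $\epsilon\,\partial_{\mathbf n}\phi=\phi_d$ at $y=d$ ($\mathbf n$ the outward normal). Here $\phi_a,\phi_b$ are prescribed data (possibly depending on $j$) and $\phi_c,\phi_d$ are prescribed data (possibly depending on $i$); the index is suppressed. They are imposed by the ghost values $$\phi_{0,j}=2\phi_a-\phi_{1,j},\quad \phi_{N_x+1,j}=2\phi_b-\phi_{N_x,j},\quad \phi_{i,0}=\phi_{i,1}+\tfrac{\Delta y}{\epsilon}\phi_c,\quad \phi_{i,N_y+1}=\phi_{i,N_y}+\tfrac{\Delta y}{\epsilon}\phi_d .$$ **Discrete Poisson constraint (P).** For all $1\le i\le N_x$, $1\le j\le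 N_y$, with these ghost values, $$-p_{i,j}+n_{i,j}-\epsilon\left(\frac{\phi_{i+1,j}-2\phi_{i,j}+\phi_{i-1,j}}{\Delta x^2}+\frac{\phi_{i,j+1}-2\phi_{i,j}+\phi_{i,j-1}}{\Delta y^2}\right)=\psi^0_{i,j}.$$ (Equivalently $-p+n+\epsilon L_\phi\phi=\psi^0+F^{bc}$, where $L_\phi$ is the discrete negative Laplacian with the homogeneous boundary conditions built in and $F^{bc}$ collects the boundary data.) **Discrete energy.** With the convention $0\log 0=0$, for $p,n\ge 0$, $$\begin{aligned}\mathcal E^h(p,n,\phi)=&\sum_{i=1}^{N_x}\sum_{j=1}^{N_y}\Big(\sum_{\rho=p,n}\big(\rho_{i,j}\log\rho_{i,j}+\tfrac12\sum_{\eta=p,n}g_{\rho\eta}\rho_{i,j}\eta_{i,j}\big)+\tfrac12(p_{i,j}-n_{i,j}+\psi^0_{i,j})\phi_{i,j}\Big)\Delta x\Delta y\\ &-\tfrac12\sum_{j=1}^{N_y}\epsilon\big(-\phi_a\mathcal D_x\phi_{\frac12,j}+\phi_b\mathcal D_x\phi_{N_x+\frac12,j}\big)\Delta y+\tfrac12\sum_{i=1}^{N_x}\big(\phi_c\mathcal A_y\phi_{i,\frac12}+\phi_d\mathcal A_y\phi_{i,N_y+\frac12}\big)\Delta x\\ &+\sum_{\rho=p,n}\frac{\sigma_\rho}{2}\Big(\sum_{j=1}^{N_y}\sum_{i=1}^{N_x-1}(\mathcal D_x\rho_{i+\frac12,j})^2+\sum_{i=1}^{N_x}\sum_{j=1}^{N_y-1}(\mathcal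 D_y\rho_{i,j+\frac12})^2\Big)\Delta x\Delta y .\end{aligned}$$ **Action function.** For $c\in\mathbb R$, $\boldsymbol m\in\mathbb R^2$: $\mathcal G(c,\boldsymbol m)=|\boldsymbol m|^2/c$ if $c>0$; $\mathcal G(0,\boldsymbol 0)=0$; $\mathcal G(c,\boldsymbol m)=+\infty$ otherwise. **Fully discrete Poisson-constrained JKO problem with data $(p^k,n^k)$.** Over all real grid functions $u=(p,\boldsymbol m_p;n,\boldsymbol m_n;\phi)$, where $\boldsymbol m_\rho=(m^x_\rho,m^y_\rho)$ for $\rho=p,n$, minimize $$\sum_{i=1}^{N_x}\sum_{j=1}^{N_y}\big(\mathcal G(p_{i,j},(\boldsymbol m_p)_{i,j})+\mathcal G(n_{i,j},(\boldsymbol m_n)_{i,j})\big)\Delta x\Delta y+2\tau\,\mathcal E^h(p,n,\phi)$$ (the objective being $+\infty$ whenever some $\mathcal G$ term is $+\infty$), subject to (P) and, for $\rho=p,n$ and all $1\le i\le N_x$, $1\le j\le N_y$, $$\rho_{i,j}+\frac{(m^x_\rho)_{i+1,j}-(m^x_\rho)_{i-1,j}}{2\Delta x}+\frac{(m^y_\rho)_{i,j+1}-(m^y_\rho)_{i,j-1}}{2\Delta y}=\rho^k_{i,j},$$ with the no-flux ghost values $(m^x_\rho)_{0,j}=-(m^x_\rho)_{1,j}$, $(m^x_\rho)_{N_x+1,j}=-(m^x_\rho)_{N_x,j}$, $(m^y_\rho)_{i,0}=-(m^y_\rho)_{i,1}$, $(m^y_\rho)_{i,N_y+1}=-(m^y_\rho)_{i,N_y}$.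 *)

theory Defs
  imports "HOL-Analysis.Analysis"
begin

datatype species = Pos | Neg  \<comment> \<open>\<open>p\<close> and \<open>n\<close>\<close>

lemma UNIV_species: "UNIV = {Pos, Neg}"
  using species.exhaust by auto

instance species :: finite
  by standard (simp add: UNIV_species)

text \<open>Cells are indexed by \<open>1 \<le> i \<le> Nx\<close>, \<open>1 \<le> j \<le> Ny\<close>. The values of a grid function at
  other indices are never read: wherever a stencil leaves the grid, the ghost extensions below
  replace them. Ranging over all total functions is thus the same as ranging over all arrays.\<close>

type_synonym 'a grid_fun = "nat \<Rightarrow> nat \<Rightarrow> 'a"

record problem =
  xa :: real  xb :: real  yc :: real  yd :: real  \<comment> \<open>\<open>\<Omega> = [xa, xb] \<times> [yc, yd]\<close>\<close>
  Nx :: nat  Ny :: nat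
  \<tau> :: real
  \<epsilon> :: real
  \<sigma> :: "species \<Rightarrow> real"
  gmat :: "real ^ species ^ species"
  \<psi>0 :: "real grid_fun"
  \<phi>a :: "nat \<Rightarrow> real"  \<phi>b :: "nat \<Rightarrow> real"  \<comment> \<open>Dirichlet data, indexed by \<open>j\<close>\<close>
  \<phi>c :: "nat \<Rightarrow> real"  \<phi>d :: "nat \<Rightarrow> real"  \<comment> \<open>Neumann data, indexed by \<open>i\<close>\<close>

record state =
  dens :: "species \<Rightarrow> real grid_fun"
  mom :: "species \<Rightarrow> (real ^ 2) grid_fun"
  pot :: "real grid_fun"

definition \<Delta>x :: "problem \<Rightarrow> real" where
  "\<Delta>x S = (xb S - xa S) / real (Nx S)"

definition \<Delta>y :: "problem \<Rightarrow> real" where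
  "\<Delta>y S = (yd S - yc S) / real (Ny S)"

text \<open>Half-integer indices are rounded down: \<open>Dx S f i j\<close> is the difference quotient at
  \<open>(i + 1/2, j)\<close>, and \<open>Dy S f i j\<close>, \<open>Ay f i j\<close> live at \<open>(i, j + 1/2)\<close>.\<close>

definition Dx :: "problem \<Rightarrow> real grid_fun \<Rightarrow> real grid_fun" where
  "Dx S f i j = (f (i + 1) j - f i j) / \<Delta>x S"

definition Dy :: "problem \<Rightarrow> real grid_fun \<Rightarrow> real grid_fun" where
  "Dy S f i j = (f i (j + 1) - f i j) / \<Delta>y S"

definition Ay :: "real grid_fun \<Rightarrow> real grid_fun" where
  "Ay f i j = (f i (j + 1) + f i j) / 2"

text \<open>The corner ghost cells get arbitrary values here; no stencil reads them.\<close>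

definition pot_ext :: "problem \<Rightarrow> real grid_fun \<Rightarrow> real grid_fun" where
  "pot_ext S \<phi> i j =
     (if i = 0 then 2 * \<phi>a S j - \<phi> 1 j
      else if i = Nx S + 1 then 2 * \<phi>b S j - \<phi> (Nx S) j
      else if j = 0 then \<phi> i 1 + \<Delta>y S / \<epsilon> S * \<phi>c S i
      else if j = Ny S + 1 then \<phi> i (Ny S) + \<Delta>y S / \<epsilon> S * \<phi>d S i
      else \<phi> i j)"

definition mom_x_ext :: "problem \<Rightarrow> (real ^ 2) grid_fun \<Rightarrow> real grid_fun" where
  "mom_x_ext S m i j =
     (if i = 0 then - (m 1 j $ 1)
      else if i = Nx S + 1 then - (m (Nx S) j $ 1)
      else m i j $ 1)"

definition mom_y_ext :: "problem \<Rightarrow> (real ^ 2) grid_fun \<Rightarrow> real grid_fun" where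
  "mom_y_ext S m i j =
     (if j = 0 then - (m i 1 $ 2)
      else if j = Ny S + 1 then - (m i (Ny S) $ 2)
      else m i j $ 2)"

definition poisson :: "problem \<Rightarrow> (species \<Rightarrow> real grid_fun) \<Rightarrow> real grid_fun \<Rightarrow> bool" where
  "poisson S \<rho> \<phi> \<longleftrightarrow>
     (let \<Phi> = pot_ext S \<phi> in
      \<forall>i\<in>{1..Nx S}. \<forall>j\<in>{1..Ny S}.
        - \<rho> Pos i j + \<rho> Neg i j
        - \<epsilon> S * ((\<Phi> (i + 1) j - 2 * \<Phi> i j + \<Phi> (i - 1) j) / (\<Delta>x S)\<^sup>2
               + (\<Phi> i (j + 1) - 2 * \<Phi> i j + \<Phi> i (j - 1)) / (\<Delta>y S)\<^sup>2)
        = \<psi>0 S i j)"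

text \<open>The energy is meaningful for nonnegative densities only, with \<open>0 * ln 0 = 0\<close>. For other
  densities its (junk) value is irrelevant, as the action in the objective is then infinite.\<close>

definition energy :: "problem \<Rightarrow> (species \<Rightarrow> real grid_fun) \<Rightarrow> real grid_fun \<Rightarrow> real" where
  "energy S \<rho> \<phi> =
     (let \<Phi> = pot_ext S \<phi> in
      (\<Sum>i=1..Nx S. \<Sum>j=1..Ny S.
         ((\<Sum>s\<in>UNIV. \<rho> s i j * ln (\<rho> s i j)
             + 1/2 * (\<Sum>t\<in>UNIV. gmat S $ s $ t * \<rho> s i j * \<rho> t i j))
          + 1/2 * (\<rho> Pos i j - \<rho> Neg i j + \<psi>0 S i j) * \<phi> i j) * \<Delta>x S * \<Delta>y S)
      - 1/2 * (\<Sum>j=1..Ny S.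
          \<epsilon> S * (- \<phi>a S j * Dx S \<Phi> 0 j + \<phi>b S j * Dx S \<Phi> (Nx S) j) * \<Delta>y S)
      + 1/2 * (\<Sum>i=1..Nx S.
          (\<phi>c S i * Ay \<Phi> i 0 + \<phi>d S i * Ay \<Phi> i (Ny S)) * \<Delta>x S)
      + (\<Sum>s\<in>UNIV. \<sigma> S s / 2 *
          ((\<Sum>j=1..Ny S. \<Sum>i=1..<Nx S. (Dx S (\<rho> s) i j)\<^sup>2)
           + (\<Sum>i=1..Nx S. \<Sum>j=1..<Ny S. (Dy S (\<rho> s) i j)\<^sup>2)) * \<Delta>x S * \<Delta>y S))"

definition action :: "real \<Rightarrow> real ^ 2 \<Rightarrow> ereal" where
  "action c m =
     (if c > 0 then ereal ((norm m)\<^sup>2 / c) else if c = 0 \<and> m = 0 then 0 else \<infinity>)"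

definition jko_objective :: "problem \<Rightarrow> state \<Rightarrow> ereal" where
  "jko_objective S u =
     (\<Sum>i=1..Nx S. \<Sum>j=1..Ny S.
        (\<Sum>s\<in>UNIV. action (dens u s i j) (mom u s i j)) * ereal (\<Delta>x S * \<Delta>y S))
     + ereal (2 * \<tau> S * energy S (dens u) (pot u))"

definition jko_feasible :: "problem \<Rightarrow> (species \<Rightarrow> real grid_fun) \<Rightarrow> state \<Rightarrow> bool" where
  "jko_feasible S \<rho>k u \<longleftrightarrow>
     poisson S (dens u) (pot u) \<and>
     (\<forall>s. \<forall>i\<in>{1..Nx S}. \<forall>j\<in>{1..Ny S}.
        dens u s i j
        + (mom_x_ext S (mom u s) (i + 1) j - mom_x_ext S (mom u s) (i - 1) j) / (2 * \<Delta>x S)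
        + (mom_y_ext S (mom u s) i (j + 1) - mom_y_ext S (mom u s) i (j - 1)) / (2 * \<Delta>y S)
        = \<rho>k s i j)"

definition jko_minimizer :: "problem \<Rightarrow> (species \<Rightarrow> real grid_fun) \<Rightarrow> state \<Rightarrow> bool" where
  "jko_minimizer S \<rho>k = is_arg_min (jko_objective S) (jko_feasible S \<rho>k)"

definition mass :: "problem \<Rightarrow> real grid_fun \<Rightarrow> real" where
  "mass S f = (\<Sum>i=1..Nx S. \<Sum>j=1..Ny S. f i j * \<Delta>x S * \<Delta>y S)"

end

theory Submission
  imports Defs
begin

text \<open>The old densities and potential with zero momenta are an admissible competitor (the Poisson
  constraint propagates in time), whose objective is \<open>2 \<tau>\<close> times the old energy. Comparison with it
  makes the action of the minimizer finite, hence its densities nonnegative, and, the action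
  being nonnegative, the energy nonincreasing. Mass is conserved because the central differences
  of the momenta telescope to zero under the no-flux ghost values.\<close>

lemma action_nonneg: "action c m \<ge> 0"
  by (simp add: action_def)

lemma action_zero: "c \<ge> 0 \<Longrightarrow> action c 0 = 0"
  by (auto simp: action_def zero_ereal_def)

lemma action_neg: "c < 0 \<Longrightarrow> action c m = \<infinity>"
  by (simp add: action_def)

text \<open>Isolates the only part of the objective that can be infinite; the energy part is a real
  number.\<close>

definition total_action :: "problem \<Rightarrow> state \<Rightarrow> ereal" where
  "total_action S u =
     (\<Sum>i=1..Nx S. \<Sum>j=1..Ny S.
        (\<Sum>s\<in>UNIV. action (dens u s i j) (mom u s i j)) * ereal (\<Delta>x S * \<Delta>y S))"

lemma jko_objective_eq:
  "jko_objective S u = total_action S u + ereal (2 * \<tau> S * energy S (dens u) (pot u))"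
  by (simp add: jko_objective_def total_action_def)

lemma total_action_nonneg:
  assumes "\<Delta>x S * \<Delta>y S \<ge> 0"
  shows "total_action S u \<ge> 0"
  unfolding total_action_def using assms
  by (intro sum_nonneg ereal_0_le_mult) (auto intro: action_nonneg)

text \<open>One negative density makes one action infinite, and no other summand can compensate for
  it.\<close>

lemma dens_nonneg_if_total_action_finite:
  assumes "total_action S u \<noteq> \<infinity>" and "\<Delta>x S * \<Delta>y S > 0"
    and "i \<in> {1..Nx S}" and "j \<in> {1..Ny S}"
  shows "dens u s i j \<ge> 0"
proof (rule ccontr)
  assume "\<not> dens u s i j \<ge> 0"
  then have "action (dens u s i j) (mom u s i j) = \<infinity>"
    by (simp add: action_neg)
  then have "(\<Sum>s\<in>UNIV. action (dens u s i j) (mom u s i j)) = \<infinity>"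
    using sum_Pinfty[of "\<lambda>s. action (dens u s i j) (mom u s i j)" UNIV] by auto
  \<comment> \<open>Since \<open>\<infinity> * 0 = 0\<close> in \<open>ereal\<close>, the cell area
    has to be strictly positive here.\<close>
  then have "(\<Sum>s\<in>UNIV. action (dens u s i j) (mom u s i j)) * ereal (\<Delta>x S * \<Delta>y S) = \<infinity>"
    using assms(2) by (simp add: zero_less_mult_iff split: if_splits) auto
  then have "total_action S u = \<infinity>"
    unfolding total_action_def using assms(3,4) unfolding sum_Pinfty by blast
  with assms(1) show False by contradiction
qed

lemma mom_ext_zero [simp]:
  "mom_x_ext S (\<lambda>_ _. 0) i j = 0" "mom_y_ext S (\<lambda>_ _. 0) i j = 0"
  by (simp_all add: mom_x_ext_def mom_y_ext_def)

text \<open>Without momentum the continuity constraint only asks that the densities equal the old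
  ones, which leaves the Poisson constraint on the old state.\<close>

lemma jko_feasible_at_rest:
  fixes v :: state
  assumes "poisson S (dens v) (pot v)"
  shows "jko_feasible S (dens v) (v\<lparr>mom := \<lambda>_ _ _. 0\<rparr>)"
  using assms by (simp add: jko_feasible_def)

text \<open>Vacuum cells cost nothing either, because \<open>action 0 0 = 0\<close>.\<close>

lemma jko_objective_at_rest:
  fixes v :: state
  assumes "\<And>s i j. i \<in> {1..Nx S} \<Longrightarrow> j \<in> {1..Ny S} \<Longrightarrow> dens v s i j \<ge> 0"
  shows "jko_objective S (v\<lparr>mom := \<lambda>_ _ _. 0\<rparr>) = ereal (2 * \<tau> S * energy S (dens v) (pot v))"
  using assms by (simp add: jko_objective_eq total_action_def action_zero)

text \<open>Each summand is \<open>(f (i + 1) - f i) + (f i - f (i - 1))\<close>, giving two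
  telescoping sums. As \<open>i \<ge> 1\<close>, the index \<open>i - 1\<close> is never
  truncated.\<close>

lemma sum_central_diff:
  fixes f :: "nat \<Rightarrow> 'a::ab_group_add"
  shows "(\<Sum>i=1..n. f (i + 1) - f (i - 1)) = f (n + 1) + f n - f 1 - f 0"
  by (induction n) (simp_all add: algebra_simps)

text \<open>The four surviving boundary values cancel in pairs: each ghost value is minus the value
  in the adjacent cell.\<close>

lemma sum_mom_x_ext:
  assumes "Nx S \<ge> 1"
  shows "(\<Sum>i=1..Nx S. mom_x_ext S m (i + 1) j - mom_x_ext S m (i - 1) j) = 0"
  unfolding sum_central_diff[of "\<lambda>i. mom_x_ext S m i j"]
  using assms by (simp add: mom_x_ext_def)

lemma sum_mom_y_ext:
  assumes "Ny S \<ge> 1"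
  shows "(\<Sum>j=1..Ny S. mom_y_ext S m i (j + 1) - mom_y_ext S m i (j - 1)) = 0"
  unfolding sum_central_diff[of "\<lambda>j. mom_y_ext S m i j"]
  using assms by (simp add: mom_y_ext_def)

lemma jko_feasible_mass:
  assumes "jko_feasible S \<rho> u" and "Nx S \<ge> 1" and "Ny S \<ge> 1"
  shows "mass S (dens u s) = mass S (\<rho> s)"
proof -
  let ?X = "\<lambda>i j. mom_x_ext S (mom u s) (i + 1) j - mom_x_ext S (mom u s) (i - 1) j"
  let ?Y = "\<lambda>i j. mom_y_ext S (mom u s) i (j + 1) - mom_y_ext S (mom u s) i (j - 1)"
  \<comment> \<open>A flux telescopes only along its own direction, so the sum over \<open>i\<close>
    must first become the inner one.\<close>
  have X: "(\<Sum>i=1..Nx S. \<Sum>j=1..Ny S. ?X i j / (2 * \<Delta>x S)) = 0"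
    using sum_mom_x_ext[OF assms(2)]
    by (subst sum.swap) (simp flip: sum_divide_distrib)
  have Y: "(\<Sum>i=1..Nx S. \<Sum>j=1..Ny S. ?Y i j / (2 * \<Delta>y S)) = 0"
    using sum_mom_y_ext[OF assms(3)] by (simp flip: sum_divide_distrib)
  have "(\<Sum>i=1..Nx S. \<Sum>j=1..Ny S. \<rho> s i j)
      = (\<Sum>i=1..Nx S. \<Sum>j=1..Ny S. dens u s i j + ?X i j / (2 * \<Delta>x S) + ?Y i j / (2 * \<Delta>y S))"
    using assms(1) unfolding jko_feasible_def by (intro sum.cong refl) simp
  also have "\<dots> = (\<Sum>i=1..Nx S. \<Sum>j=1..Ny S. dens u s i j)"
    unfolding sum.distrib X Y by simp
  finally show ?thesis
    by (simp add: mass_def flip: sum_distrib_right)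
qed

lemma jko_step:
  fixes u v :: state
  assumes min: "jko_minimizer S (dens v) u"
    and poisson: "poisson S (dens v) (pot v)"
    and nonneg: "\<And>s i j. i \<in> {1..Nx S} \<Longrightarrow> j \<in> {1..Ny S} \<Longrightarrow> dens v s i j \<ge> 0"
    and cell: "\<Delta>x S * \<Delta>y S > 0" and "\<tau> S > 0"
  shows "energy S (dens u) (pot u) \<le> energy S (dens v) (pot v)"
    and "\<And>s i j. i \<in> {1..Nx S} \<Longrightarrow> j \<in> {1..Ny S} \<Longrightarrow> dens u s i j \<ge> 0"
proof -
  \<comment> \<open>\<open>is_arg_min\<close> merely excludes feasible states with a strictly
    smaller objective; linearity of the order on \<open>ereal\<close> yields
    \<open>\<le>\<close>.\<close>
  have "jko_objective S u \<le> jko_objective S (v\<lparr>mom := \<lambda>_ _ _. 0\<rparr>)"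
    using min jko_feasible_at_rest[OF poisson]
    by (auto simp: jko_minimizer_def is_arg_min_def not_less)
  then have le: "total_action S u + ereal (2 * \<tau> S * energy S (dens u) (pot u))
      \<le> ereal (2 * \<tau> S * energy S (dens v) (pot v))"
    using jko_objective_at_rest[of S v] nonneg by (simp only: jko_objective_eq[of S u])
  then have "total_action S u \<noteq> \<infinity>"
    by auto
  then show "dens u s i j \<ge> 0" if "i \<in> {1..Nx S}" "j \<in> {1..Ny S}" for s i j
    using dens_nonneg_if_total_action_finite cell that by blast
  have "ereal (2 * \<tau> S * energy S (dens u) (pot u))
      \<le> total_action S u + ereal (2 * \<tau> S * energy S (dens u) (pot u))"
    using cell total_action_nonneg[of S u] by (simp add: ereal_le_add_self2)
  from order_trans[OF this le] have "ereal (2 * \<tau> S * energy S (dens u) (pot u))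
      \<le> ereal (2 * \<tau> S * energy S (dens v) (pot v))" .
  then show "energy S (dens u) (pot u) \<le> energy S (dens v) (pot v)"
    using \<open>\<tau> S > 0\<close> by simp
qed

theorem theorem3p1:
  fixes S :: problem and u :: "nat \<Rightarrow> state"
  assumes "xa S < xb S" and "yc S < yd S" and "Nx S \<ge> 1" and "Ny S \<ge> 1"
    and "\<tau> S > 0" and "\<epsilon> S > 0" and "\<And>s. \<sigma> S s \<ge> 0"
    and "transpose (gmat S) = gmat S" and "\<And>v. v \<bullet> (gmat S *v v) \<ge> 0"
    and "\<And>s i j. i \<in> {1..Nx S} \<Longrightarrow> j \<in> {1..Ny S} \<Longrightarrow> dens (u 0) s i j \<ge> 0"
    and "poisson S (dens (u 0)) (pot (u 0))"
    and "\<And>k. jko_minimizer S (dens (u k)) (u (Suc k))"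
  shows "\<forall>k. energy S (dens (u (Suc k))) (pot (u (Suc k))) \<le> energy S (dens (u k)) (pot (u k))
           \<and> (\<forall>s. mass S (dens (u (Suc k)) s) = mass S (dens (u k) s))
           \<and> (\<forall>s. \<forall>i\<in>{1..Nx S}. \<forall>j\<in>{1..Ny S}. dens (u (Suc k)) s i j \<ge> 0)"
proof -
  have cell: "\<Delta>x S * \<Delta>y S > 0"
    using assms(1-4) by (simp add: \<Delta>x_def \<Delta>y_def)
  have feasible: "jko_feasible S (dens (u k)) (u (Suc k))" for k
    using assms(12)[of k] by (simp add: jko_minimizer_def is_arg_min_def)
  \<comment> \<open>The initial state satisfies the constraint by hypothesis, every later one as a
    feasible point of its own problem.\<close>
  have poisson: "poisson S (dens (u k)) (pot (u k))" for k
    using assms(11) feasible by (cases k) (auto simp: jko_feasible_def)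
  note step = jko_step[OF assms(12) poisson _ cell assms(5)]
  \<comment> \<open>Induction is used because the rest state built from step \<open>k\<close> has
    finite objective only if its densities are nonnegative.\<close>
  have nonneg: "\<And>s i j. i \<in> {1..Nx S} \<Longrightarrow> j \<in> {1..Ny S} \<Longrightarrow> dens (u k) s i j \<ge> 0" for k
  proof (induction k)
    case 0
    then show ?case by (rule assms(10))
  next
    case (Suc k)
    from step(2)[OF Suc.IH Suc.prems] show ?case .
  qed
  show ?thesis
    using step(1)[OF nonneg] nonneg jko_feasible_mass[OF feasible assms(3,4)] by blast
qed

end
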